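(* Let $\mathcal{A}$ be a commutative $C^*$-algebra, i.e. $\mathcal{A}\cong C_0(K)$, where $K$ is a locally compact Hausdorff space. Then the following statements are equivalent: 1) $C_0(K)$ is locally unital, but not unital. 2) $K\in\mathcal{K}_{\mathrm{IV}}$, i.e. any $\sigma$-compact subset in $K$ is precompact. 3) Any function $f\in C_0(K)$ vanishes outside some compact set which depends on $f$ (i.e. $f$ has a compact support).
   Context: A self-adjoint element $h$ of a $C^*$-algebra $\mathcal{A}$ is called a local unit for an element $a\in\mathcal{A}$ if $ah=ha=a$. A $C^*$-algebra $\mathcal{A}$ is locally unital if every $a\in\mathcal{A}$ has a local unit in $\mathcal{A}$. $C_0(K)$ is the $C^*$-algebra of continuous complex-valued functions on $K$ vanishing at infinity. A subset is $\sigma$-compact if it is a countable union of compact subsets, and precompact if its closure in $K$ is compact. $\mathcal{K}_{\mathrm{IV}}$ denotes the class of spaces such that the complement to any $\sigma$-compact subset has an interior point, and (in the one-point compactification) the point at infinity is always interior for the complement; the class is described equivalently as the spaces in which every $\sigma$-compact subset is precompact.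
   Formalization: K is additionally assumed to be non-compact: for compact K (e.g. a single point) 3) holds and any σ-compact subset is precompact, but C_0(K) is unital, so 1) fails and the printed equivalence is false. *)

theory Defs
  imports "HOL-Analysis.Analysis"
begin

section \<open>C*-algebras, not necessarily unital\<close>

record 'a star_algebra =
  carrier :: "'a set"
  add :: "'a \<Rightarrow> 'a \<Rightarrow> 'a" (infixl \<open>\<oplus>\<index>\<close> 65)
  zero :: "'a" (\<open>\<zero>\<index>\<close>)
  scale :: "complex \<Rightarrow> 'a \<Rightarrow> 'a" (infixr \<open>\<odot>\<index>\<close> 75)
  mult :: "'a \<Rightarrow> 'a \<Rightarrow> 'a" (infixl \<open>\<otimes>\<index>\<close> 70)
  star :: "'a \<Rightarrow> 'a"
  nrm :: "'a \<Rightarrow> real"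

definition norm_dist :: "('a, 'm) star_algebra_scheme \<Rightarrow> 'a \<Rightarrow> 'a \<Rightarrow> real"
  where "norm_dist A x y = nrm A (x \<oplus>\<^bsub>A\<^esub> (-1) \<odot>\<^bsub>A\<^esub> y)"

locale cstar_algebra =
  fixes A :: "('a, 'm) star_algebra_scheme" (structure)
  assumes add_closed: "\<lbrakk>x \<in> carrier A; y \<in> carrier A\<rbrakk> \<Longrightarrow> x \<oplus> y \<in> carrier A"
    and zero_closed: "\<zero> \<in> carrier A"
    and scale_closed: "x \<in> carrier A \<Longrightarrow> c \<odot> x \<in> carrier A"
    and mult_closed: "\<lbrakk>x \<in> carrier A; y \<in> carrier A\<rbrakk> \<Longrightarrow> x \<otimes> y \<in> carrier A"
    and star_closed: "x \<in> carrier A \<Longrightarrow> star A x \<in> carrier A"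
    and add_assoc: "\<lbrakk>x \<in> carrier A; y \<in> carrier A; z \<in> carrier A\<rbrakk>
          \<Longrightarrow> (x \<oplus> y) \<oplus> z = x \<oplus> (y \<oplus> z)"
    and add_comm: "\<lbrakk>x \<in> carrier A; y \<in> carrier A\<rbrakk> \<Longrightarrow> x \<oplus> y = y \<oplus> x"
    and add_zero: "x \<in> carrier A \<Longrightarrow> x \<oplus> \<zero> = x"
    and add_inverse: "x \<in> carrier A \<Longrightarrow> x \<oplus> (-1) \<odot> x = \<zero>"
    and scale_one: "x \<in> carrier A \<Longrightarrow> 1 \<odot> x = x"
    and scale_scale: "x \<in> carrier A \<Longrightarrow> c \<odot> d \<odot> x = (c * d) \<odot> x"
    and scale_add_left: "x \<in> carrier A \<Longrightarrow> (c + d) \<odot> x = c \<odot> x \<oplus> d \<odot> x"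
    and scale_add_right: "\<lbrakk>x \<in> carrier A; y \<in> carrier A\<rbrakk>
          \<Longrightarrow> c \<odot> (x \<oplus> y) = c \<odot> x \<oplus> c \<odot> y"
    and mult_assoc: "\<lbrakk>x \<in> carrier A; y \<in> carrier A; z \<in> carrier A\<rbrakk>
          \<Longrightarrow> (x \<otimes> y) \<otimes> z = x \<otimes> (y \<otimes> z)"
    and mult_add_left: "\<lbrakk>x \<in> carrier A; y \<in> carrier A; z \<in> carrier A\<rbrakk>
          \<Longrightarrow> (x \<oplus> y) \<otimes> z = x \<otimes> z \<oplus> y \<otimes> z"
    and mult_add_right: "\<lbrakk>x \<in> carrier A; y \<in> carrier A; z \<in> carrier A\<rbrakk>
          \<Longrightarrow> x \<otimes> (y \<oplus> z) = x \<otimes> y \<oplus> x \<otimes> z"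
    and mult_scale_left: "\<lbrakk>x \<in> carrier A; y \<in> carrier A\<rbrakk>
          \<Longrightarrow> (c \<odot> x) \<otimes> y = c \<odot> (x \<otimes> y)"
    and mult_scale_right: "\<lbrakk>x \<in> carrier A; y \<in> carrier A\<rbrakk>
          \<Longrightarrow> x \<otimes> (c \<odot> y) = c \<odot> (x \<otimes> y)"
    and star_star: "x \<in> carrier A \<Longrightarrow> star A (star A x) = x"
    and star_add: "\<lbrakk>x \<in> carrier A; y \<in> carrier A\<rbrakk>
          \<Longrightarrow> star A (x \<oplus> y) = star A x \<oplus> star A y"
    and star_scale: "x \<in> carrier A \<Longrightarrow> star A (c \<odot> x) = cnj c \<odot> star A x"
    and star_mult: "\<lbrakk>x \<in> carrier A; y \<in> carrier A\<rbrakk>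
          \<Longrightarrow> star A (x \<otimes> y) = star A y \<otimes> star A x"
    and nrm_nonneg: "x \<in> carrier A \<Longrightarrow> 0 \<le> nrm A x"
    and nrm_eq_0: "x \<in> carrier A \<Longrightarrow> nrm A x = 0 \<longleftrightarrow> x = \<zero>"
    and nrm_scale: "x \<in> carrier A \<Longrightarrow> nrm A (c \<odot> x) = cmod c * nrm A x"
    and nrm_triangle: "\<lbrakk>x \<in> carrier A; y \<in> carrier A\<rbrakk>
          \<Longrightarrow> nrm A (x \<oplus> y) \<le> nrm A x + nrm A y"
    and nrm_mult: "\<lbrakk>x \<in> carrier A; y \<in> carrier A\<rbrakk>
          \<Longrightarrow> nrm A (x \<otimes> y) \<le> nrm A x * nrm A y"
    and nrm_cstar: "x \<in> carrier A \<Longrightarrow> nrm A (star A x \<otimes> x) = (nrm A x)\<^sup>2"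
    and complete: "\<lbrakk>\<And>n. s n \<in> carrier A;
          \<And>\<epsilon>. 0 < \<epsilon> \<Longrightarrow> \<exists>N. \<forall>m\<ge>N. \<forall>n\<ge>N. norm_dist A (s m) (s n) < \<epsilon>\<rbrakk>
          \<Longrightarrow> \<exists>x\<in>carrier A. (\<lambda>n. norm_dist A (s n) x) \<longlonglongrightarrow> 0"

locale comm_cstar_algebra = cstar_algebra +
  assumes mult_comm: "\<lbrakk>x \<in> carrier A; y \<in> carrier A\<rbrakk> \<Longrightarrow> x \<otimes> y = y \<otimes> x"

text \<open>Isometry is not required of a *-isomorphism: between C*-algebras it is automatic.\<close>

definition star_iso ::
    "('a, 'm) star_algebra_scheme \<Rightarrow> ('b, 'n) star_algebra_scheme \<Rightarrow> ('a \<Rightarrow> 'b) \<Rightarrow> bool"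
  where "star_iso A B \<phi> \<longleftrightarrow>
    bij_betw \<phi> (carrier A) (carrier B) \<and>
    (\<forall>x\<in>carrier A. \<forall>y\<in>carrier A. \<phi> (x \<oplus>\<^bsub>A\<^esub> y) = \<phi> x \<oplus>\<^bsub>B\<^esub> \<phi> y) \<and>
    (\<forall>c. \<forall>x\<in>carrier A. \<phi> (c \<odot>\<^bsub>A\<^esub> x) = c \<odot>\<^bsub>B\<^esub> \<phi> x) \<and>
    (\<forall>x\<in>carrier A. \<forall>y\<in>carrier A. \<phi> (x \<otimes>\<^bsub>A\<^esub> y) = \<phi> x \<otimes>\<^bsub>B\<^esub> \<phi> y) \<and>
    (\<forall>x\<in>carrier A. \<phi> (star A x) = star B (\<phi> x))"

definition star_isomorphic ::
    "('a, 'm) star_algebra_scheme \<Rightarrow> ('b, 'n) star_algebra_scheme \<Rightarrow> bool"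
  where "star_isomorphic A B \<longleftrightarrow> (\<exists>\<phi>. star_iso A B \<phi>)"

definition local_unit :: "('a, 'm) star_algebra_scheme \<Rightarrow> 'a \<Rightarrow> 'a \<Rightarrow> bool"
  where "local_unit A h a \<longleftrightarrow>
    h \<in> carrier A \<and> star A h = h \<and> a \<otimes>\<^bsub>A\<^esub> h = a \<and> h \<otimes>\<^bsub>A\<^esub> a = a"

definition locally_unital :: "('a, 'm) star_algebra_scheme \<Rightarrow> bool"
  where "locally_unital A \<longleftrightarrow> (\<forall>a\<in>carrier A. \<exists>h. local_unit A h a)"

definition unital :: "('a, 'm) star_algebra_scheme \<Rightarrow> bool"
  where "unital A \<longleftrightarrow>
    (\<exists>e\<in>carrier A. \<forall>a\<in>carrier A. e \<otimes>\<^bsub>A\<^esub> a = a \<and> a \<otimes>\<^bsub>A\<^esub> e = a)"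


section \<open>The algebra of continuous functions vanishing at infinity\<close>

definition vanishes_at_infinity :: "'k topology \<Rightarrow> ('k \<Rightarrow> complex) \<Rightarrow> bool"
  where "vanishes_at_infinity K f \<longleftrightarrow>
    (\<forall>\<epsilon>>0. \<exists>C. compactin K C \<and> (\<forall>x\<in>topspace K - C. cmod (f x) < \<epsilon>))"

definition vanishes_outside_compact :: "'k topology \<Rightarrow> ('k \<Rightarrow> complex) \<Rightarrow> bool"
  where "vanishes_outside_compact K f \<longleftrightarrow>
    (\<exists>C. compactin K C \<and> (\<forall>x\<in>topspace K - C. f x = 0))"

text \<open>
  Functions on the space are represented by HOL functions that take the value \<^const>\<open>undefined\<close>
  outside \<^term>\<open>topspace K\<close>, so that equality in the algebra is equality on the space.
  The 0 inserted under the supremum only matters for the empty space.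
\<close>

definition C0 :: "'k topology \<Rightarrow> ('k \<Rightarrow> complex) star_algebra"
  where "C0 K = \<lparr>
    carrier = {f \<in> extensional (topspace K).
                 continuous_map K euclidean f \<and> vanishes_at_infinity K f},
    add = (\<lambda>f g. \<lambda>x\<in>topspace K. f x + g x),
    zero = (\<lambda>x\<in>topspace K. 0),
    scale = (\<lambda>c f. \<lambda>x\<in>topspace K. c * f x),
    mult = (\<lambda>f g. \<lambda>x\<in>topspace K. f x * g x),
    star = (\<lambda>f. \<lambda>x\<in>topspace K. cnj (f x)),
    nrm = (\<lambda>f. Sup (insert 0 ((\<lambda>x. cmod (f x)) ` topspace K)))\<rparr>"


section \<open>Sigma-compact and precompact sets, and the class K_IV\<close>

definition sigma_compactin :: "'k topology \<Rightarrow> 'k set \<Rightarrow> bool"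
  where "sigma_compactin K S \<longleftrightarrow>
    (\<exists>\<C>. countable \<C> \<and> (\<forall>C\<in>\<C>. compactin K C) \<and> S = \<Union>\<C>)"

definition precompactin :: "'k topology \<Rightarrow> 'k set \<Rightarrow> bool"
  where "precompactin K S \<longleftrightarrow> S \<subseteq> topspace K \<and> compactin K (K closure_of S)"

text \<open>
  In \<^const>\<open>Alexandroff_compactification\<close> the point at infinity is \<^const>\<open>None\<close> and
  \<^const>\<open>Some\<close> embeds the space.
\<close>

definition class_IV :: "'k topology \<Rightarrow> bool"
  where "class_IV K \<longleftrightarrow>
    (\<forall>S. sigma_compactin K S \<longrightarrow>
      K interior_of (topspace K - S) \<noteq> {} \<and>
      None \<in> Alexandroff_compactification K interior_of
               (topspace (Alexandroff_compactification K) - Some ` S))"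


section \<open>The continuous functions vanishing at infinity form a commutative C*-algebra\<close>

lemma C0_carrierI:
  assumes "f \<in> extensional (topspace K)" "continuous_map K euclidean f"
    and "vanishes_at_infinity K f"
  shows "f \<in> carrier (C0 K)"
  using assms by (simp add: C0_def)

lemma C0_carrierD:
  assumes "f \<in> carrier (C0 K)"
  shows "f \<in> extensional (topspace K)" "continuous_map K euclidean f"
    "vanishes_at_infinity K f"
  using assms by (simp_all add: C0_def)

lemma C0_bounded:
  assumes "f \<in> carrier (C0 K)"
  obtains B where "0 \<le> B" "\<And>x. x \<in> topspace K \<Longrightarrow> cmod (f x) \<le> B"
proof -
  obtain C where C: "compactin K C" "\<And>x. x \<in> topspace K - C \<Longrightarrow> cmod (f x) < 1"
    using C0_carrierD(3)[OF assms] unfolding vanishes_at_infinity_def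
    by (metis zero_less_one)
  have "compact (f ` C)"
    using image_compactin[OF C(1) C0_carrierD(2)[OF assms]] by simp
  then obtain B where B: "\<And>x. x \<in> C \<Longrightarrow> cmod (f x) \<le> B"
    by (meson bounded_iff compact_imp_bounded imageI)
  show ?thesis
  proof (rule that[of "max 1 B"])
    fix x assume "x \<in> topspace K"
    then show "cmod (f x) \<le> max 1 B"
      using B[of x] C(2)[of x] by (cases "x \<in> C") auto
  qed auto
qed

lemma C0_nrm_eq: "nrm (C0 K) f = Sup (insert 0 ((\<lambda>x. cmod (f x)) ` topspace K))"
  by (simp add: C0_def)

lemma C0_nrm_le:
  assumes "0 \<le> B" "\<And>x. x \<in> topspace K \<Longrightarrow> cmod (f x) \<le> B"
  shows "nrm (C0 K) f \<le> B"
  unfolding C0_nrm_eq by (rule cSup_least) (use assms in auto)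

lemma C0_bdd:
  assumes "f \<in> carrier (C0 K)"
  shows "bdd_above (insert 0 ((\<lambda>x. cmod (f x)) ` topspace K))"
proof -
  obtain B where "0 \<le> B" "\<And>x. x \<in> topspace K \<Longrightarrow> cmod (f x) \<le> B"
    using C0_bounded[OF assms] by blast
  then show ?thesis by (intro bdd_aboveI[of _ B]) auto
qed

lemma C0_nrm_upper:
  assumes "f \<in> carrier (C0 K)" "x \<in> topspace K"
  shows "cmod (f x) \<le> nrm (C0 K) f"
  unfolding C0_nrm_eq by (rule cSup_upper[OF _ C0_bdd[OF assms(1)]]) (use assms in auto)

lemma C0_nrm_nonneg:
  assumes "f \<in> carrier (C0 K)"
  shows "0 \<le> nrm (C0 K) f"
  unfolding C0_nrm_eq by (rule cSup_upper[OF _ C0_bdd[OF assms(1)]]) auto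

lemma vanishes_at_infinity_dominated:
  assumes "vanishes_at_infinity K f" "vanishes_at_infinity K g" "0 \<le> B"
    and "\<And>x. x \<in> topspace K \<Longrightarrow> cmod (h x) \<le> B * (cmod (f x) + cmod (g x))"
  shows "vanishes_at_infinity K h"
  unfolding vanishes_at_infinity_def
proof (intro allI impI)
  fix \<epsilon> :: real assume "0 < \<epsilon>"
  define \<delta> where "\<delta> = \<epsilon> / (2 * (B + 1))"
  have d: "0 < \<delta>" using \<open>0 < \<epsilon>\<close> \<open>0 \<le> B\<close> by (simp add: \<delta>_def)
  obtain C D where CD: "compactin K C" "compactin K D"
    "\<And>x. x \<in> topspace K - C \<Longrightarrow> cmod (f x) < \<delta>" "\<And>x. x \<in> topspace K - D \<Longrightarrow> cmod (g x) < \<delta>"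
    using assms(1,2) d unfolding vanishes_at_infinity_def by metis
  have "cmod (h x) < \<epsilon>" if "x \<in> topspace K - (C \<union> D)" for x
  proof -
    have "cmod (h x) \<le> B * (cmod (f x) + cmod (g x))" using assms(4) that by auto
    also have "\<dots> \<le> B * (2 * \<delta>)"
      using CD(3,4)[of x] that \<open>0 \<le> B\<close> by (intro mult_left_mono) auto
    also have "\<dots> < (B + 1) * (2 * \<delta>)" using d by (simp add: algebra_simps)
    also have "\<dots> = \<epsilon>" using \<open>0 \<le> B\<close> by (simp add: \<delta>_def field_simps)
    finally show ?thesis .
  qed
  then show "\<exists>C. compactin K C \<and> (\<forall>x\<in>topspace K - C. cmod (h x) < \<epsilon>)"
    using compactin_Un[OF CD(1,2)] by blast
qed

lemma C0_closed_ptw: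
  assumes f: "f \<in> carrier (C0 K)" and g: "g \<in> carrier (C0 K)" and "0 \<le> B"
    and "\<And>x. x \<in> topspace K \<Longrightarrow> cmod (h x) \<le> B * (cmod (f x) + cmod (g x))"
    and "continuous_map K euclidean h"
  shows "restrict h (topspace K) \<in> carrier (C0 K)"
proof (rule C0_carrierI)
  show "continuous_map K euclidean (restrict h (topspace K))"
    using assms(5) by (rule continuous_map_eq) auto
  show "vanishes_at_infinity K (restrict h (topspace K))"
    by (rule vanishes_at_infinity_dominated[OF C0_carrierD(3)[OF f] C0_carrierD(3)[OF g] \<open>0 \<le> B\<close>])
      (use assms(4) in auto)
qed auto

lemma continuous_map_complex_mult:
  fixes f g :: "'k \<Rightarrow> complex"
  shows "\<lbrakk>continuous_map K euclidean f; continuous_map K euclidean g\<rbrakk>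
    \<Longrightarrow> continuous_map K euclidean (\<lambda>x. f x * g x)"
  by (simp add: continuous_map_atin tendsto_mult)

lemma C0_sel:
  "add (C0 K) = (\<lambda>f g. \<lambda>x\<in>topspace K. f x + g x)"
  "zero (C0 K) = (\<lambda>x\<in>topspace K. 0)"
  "scale (C0 K) = (\<lambda>c f. \<lambda>x\<in>topspace K. c * f x)"
  "mult (C0 K) = (\<lambda>f g. \<lambda>x\<in>topspace K. f x * g x)"
  "star (C0 K) = (\<lambda>f. \<lambda>x\<in>topspace K. cnj (f x))"
  by (simp_all add: C0_def)

lemma C0_zero_closed: "zero (C0 K) \<in> carrier (C0 K)"
  unfolding C0_sel
  by (rule C0_carrierI) (auto simp: vanishes_at_infinity_def intro: exI[of _ "{}"])

lemma C0_scale_closed: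
  assumes "f \<in> carrier (C0 K)"
  shows "scale (C0 K) c f \<in> carrier (C0 K)"
  unfolding C0_sel
  by (rule C0_closed_ptw[OF assms assms, of "cmod c"])
    (auto simp: norm_mult algebra_simps intro!: continuous_map_complex_mult C0_carrierD(2)[OF assms])

lemma C0_add_closed:
  assumes "f \<in> carrier (C0 K)" "g \<in> carrier (C0 K)"
  shows "add (C0 K) f g \<in> carrier (C0 K)"
  unfolding C0_sel
  by (rule C0_closed_ptw[OF assms, of 1])
    (auto simp: norm_triangle_ineq intro!: continuous_map_add C0_carrierD(2)[OF assms(1)] C0_carrierD(2)[OF assms(2)])

lemma C0_mult_closed:
  assumes f: "f \<in> carrier (C0 K)" and g: "g \<in> carrier (C0 K)"
  shows "mult (C0 K) f g \<in> carrier (C0 K)"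
proof -
  obtain B where B: "0 \<le> B" "\<And>x. x \<in> topspace K \<Longrightarrow> cmod (f x) \<le> B"
    using C0_bounded[OF f] by blast
  have *: "cmod (f x * g x) \<le> B * (cmod (f x) + cmod (g x))" if "x \<in> topspace K" for x
  proof -
    have "cmod (f x * g x) \<le> B * cmod (g x)"
      using B(2)[OF that] by (simp add: norm_mult mult_right_mono)
    also have "\<dots> \<le> B * (cmod (f x) + cmod (g x))" using B(1) by (simp add: mult_left_mono)
    finally show ?thesis .
  qed
  show ?thesis
    unfolding C0_sel
    by (rule C0_closed_ptw[OF f g B(1) *])
      (auto intro!: continuous_map_complex_mult C0_carrierD(2)[OF f] C0_carrierD(2)[OF g])
qed

lemma C0_star_closed:
  assumes "f \<in> carrier (C0 K)"
  shows "star (C0 K) f \<in> carrier (C0 K)"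
  unfolding C0_sel
proof (rule C0_closed_ptw[OF assms assms, of 1])
  have "continuous_map K euclidean (cnj \<circ> f)"
    by (rule continuous_map_compose[OF C0_carrierD(2)[OF assms]])
      (simp add: continuous_map_iff_continuous2 continuous_on_cnj)
  then show "continuous_map K euclidean (\<lambda>x. cnj (f x))" by (simp add: o_def)
qed auto

lemma C0_complete:
  assumes sc: "\<And>n. s n \<in> carrier (C0 K)"
    and cau: "\<And>e. 0 < e \<Longrightarrow> \<exists>N. \<forall>m\<ge>N. \<forall>n\<ge>N. norm_dist (C0 K) (s m) (s n) < e"
  shows "\<exists>g\<in>carrier (C0 K). (\<lambda>n. norm_dist (C0 K) (s n) g) \<longlonglongrightarrow> 0"
proof -
  let ?d = "norm_dist (C0 K)"
  have dle: "cmod (f x - g x) \<le> ?d f g"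
    if "f \<in> carrier (C0 K)" "g \<in> carrier (C0 K)" "x \<in> topspace K" for f g x
    using C0_nrm_upper[OF C0_add_closed[OF that(1) C0_scale_closed[OF that(2), of "-1"]] that(3)] that(3)
    by (simp add: norm_dist_def C0_sel)
  have dge: "?d f g \<le> B" if "0 \<le> B" "\<And>x. x \<in> topspace K \<Longrightarrow> cmod (f x - g x) \<le> B" for f g B
    unfolding norm_dist_def by (rule C0_nrm_le) (use that in \<open>auto simp: C0_sel\<close>)
    have "\<exists>l. (\<lambda>n. s n x) \<longlonglongrightarrow> l" if x: "x \<in> topspace K" for x
    proof -
      have "Cauchy (\<lambda>n. s n x)"
      proof (rule metric_CauchyI)
        fix e :: real assume "0 < e"
        then obtain N where "\<forall>n\<ge>N. \<forall>m\<ge>N. ?d (s n) (s m) < e" using cau by blast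
        then show "\<exists>N. \<forall>m\<ge>N. \<forall>n\<ge>N. dist (s m x) (s n x) < e"
          unfolding dist_norm using dle[OF sc sc x] by (meson le_less_trans)
      qed
      then show ?thesis using Cauchy_convergent convergent_def by blast
    qed
    then obtain l where l: "\<And>x. x \<in> topspace K \<Longrightarrow> (\<lambda>n. s n x) \<longlonglongrightarrow> l x" by metis
    define g where "g = restrict l (topspace K)"
    have unif: "\<exists>N. \<forall>n\<ge>N. \<forall>x\<in>topspace K. cmod (s n x - g x) \<le> e" if e: "e > 0" for e
    proof -
      obtain N where N: "\<forall>n\<ge>N. \<forall>m\<ge>N. ?d (s n) (s m) < e" using cau e by blast
      have "cmod (s n x - g x) \<le> e" if "n \<ge> N" and x: "x \<in> topspace K" for n x
      proof (rule LIMSEQ_le_const2)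
        show "(\<lambda>m. cmod (s n x - s m x)) \<longlonglongrightarrow> cmod (s n x - g x)"
          using l[OF x] x by (auto simp: g_def intro!: tendsto_intros)
        show "\<exists>N. \<forall>m\<ge>N. cmod (s n x - s m x) \<le> e"
          using N that dle[OF sc sc x] by (meson le_less_trans less_imp_le)
      qed
      then show ?thesis by blast
    qed
    have "continuous_map K euclidean g"
    proof -
      have "continuous_map K (Met_TC.mtopology :: complex topology) g"
      proof (rule Met_TC.continuous_map_uniform_limit[where F = sequentially and f = s])
        show "\<forall>\<^sub>F n in sequentially. continuous_map K Met_TC.mtopology (s n)"
          using C0_carrierD(2)[OF sc] by simp
        fix e :: real assume "0 < e"
        then obtain N where "\<forall>n\<ge>N. \<forall>x\<in>topspace K. cmod (s n x - g x) \<le> e/2"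
          using unif[of "e/2"] by auto
        then show "\<forall>\<^sub>F n in sequentially. \<forall>x\<in>topspace K. g x \<in> UNIV \<and> dist (s n x) (g x) < e"
          using \<open>0 < e\<close> unfolding eventually_sequentially dist_norm by fastforce
      qed auto
      then show ?thesis by simp
    qed
    moreover have "vanishes_at_infinity K g"
      unfolding vanishes_at_infinity_def
    proof (intro allI impI)
      fix e :: real assume "0 < e"
      then obtain N where N: "\<And>x. x \<in> topspace K \<Longrightarrow> cmod (s N x - g x) \<le> e/2"
        using unif[of "e/2"] by auto
      obtain C where C: "compactin K C" "\<And>x. x \<in> topspace K - C \<Longrightarrow> cmod (s N x) < e/2"
        using C0_carrierD(3)[OF sc[of N]] \<open>0 < e\<close> unfolding vanishes_at_infinity_def
        by (metis half_gt_zero)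
      have "cmod (g x) < e" if "x \<in> topspace K - C" for x
        using N[of x] C(2)[of x] that norm_triangle_ineq2[of "g x" "s N x"]
        by (auto simp: norm_minus_commute)
      then show "\<exists>C. compactin K C \<and> (\<forall>x\<in>topspace K - C. cmod (g x) < e)"
        using C(1) by blast
    qed
    ultimately have g: "g \<in> carrier (C0 K)"
      by (intro C0_carrierI) (auto simp: g_def)
    have nn: "0 \<le> ?d (s n) g" for n
      unfolding norm_dist_def by (intro C0_nrm_nonneg C0_add_closed C0_scale_closed sc g)
    have "(\<lambda>n. ?d (s n) g) \<longlonglongrightarrow> 0"
    proof (rule metric_LIMSEQ_I)
      fix e :: real assume "0 < e"
      then obtain N where N: "\<And>n x. \<lbrakk>n \<ge> N; x \<in> topspace K\<rbrakk> \<Longrightarrow> cmod (s n x - g x) \<le> e/2"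
        using unif[of "e/2"] by auto
      have "?d (s n) g < e" if "n \<ge> N" for n
        using dge[of "e/2" "s n" g] N[OF that] \<open>0 < e\<close> by auto
      then show "\<exists>N. \<forall>n\<ge>N. dist (?d (s n) g) 0 < e"
        using nn by auto
    qed
    then show ?thesis using g by blast
qed

lemma C0_nrm_eq_0:
  assumes "f \<in> carrier (C0 K)"
  shows "nrm (C0 K) f = 0 \<longleftrightarrow> f = zero (C0 K)"
proof
  assume "nrm (C0 K) f = 0"
  then show "f = zero (C0 K)"
    using C0_nrm_upper[OF assms] C0_carrierD(1)[OF assms]
    by (intro extensionalityI[of _ "topspace K"]) (auto simp: C0_sel)
next
  assume "f = zero (C0 K)"
  then show "nrm (C0 K) f = 0"
    using C0_nrm_nonneg[OF assms] C0_nrm_le[of 0 K f] by (auto simp: C0_sel)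
qed

lemma C0_nrm_triangle:
  assumes "f \<in> carrier (C0 K)" "g \<in> carrier (C0 K)"
  shows "nrm (C0 K) (add (C0 K) f g) \<le> nrm (C0 K) f + nrm (C0 K) g"
proof (rule C0_nrm_le)
  fix x assume x: "x \<in> topspace K"
  show "cmod (add (C0 K) f g x) \<le> nrm (C0 K) f + nrm (C0 K) g"
    using x C0_nrm_upper[OF assms(1) x] C0_nrm_upper[OF assms(2) x] norm_triangle_ineq[of "f x" "g x"]
    by (simp add: C0_sel)
qed (intro add_nonneg_nonneg C0_nrm_nonneg assms)

lemma C0_nrm_mult:
  assumes "f \<in> carrier (C0 K)" "g \<in> carrier (C0 K)"
  shows "nrm (C0 K) (mult (C0 K) f g) \<le> nrm (C0 K) f * nrm (C0 K) g"
proof (rule C0_nrm_le)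
  fix x assume x: "x \<in> topspace K"
  show "cmod (mult (C0 K) f g x) \<le> nrm (C0 K) f * nrm (C0 K) g"
    using x C0_nrm_upper[OF assms(1) x] C0_nrm_upper[OF assms(2) x] C0_nrm_nonneg[OF assms(1)]
    by (simp add: C0_sel norm_mult mult_mono)
qed (intro mult_nonneg_nonneg C0_nrm_nonneg assms)

lemma C0_nrm_scale_le:
  assumes "f \<in> carrier (C0 K)"
  shows "nrm (C0 K) (scale (C0 K) c f) \<le> cmod c * nrm (C0 K) f"
proof (rule C0_nrm_le)
  fix x assume x: "x \<in> topspace K"
  show "cmod (scale (C0 K) c f x) \<le> cmod c * nrm (C0 K) f"
    using x C0_nrm_upper[OF assms(1) x] by (simp add: C0_sel norm_mult mult_left_mono)
qed (intro mult_nonneg_nonneg norm_ge_zero C0_nrm_nonneg assms)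

lemma C0_nrm_scale:
  assumes "f \<in> carrier (C0 K)"
  shows "nrm (C0 K) (scale (C0 K) c f) = cmod c * nrm (C0 K) f"
proof (cases "c = 0")
  case True
  then show ?thesis
    using C0_nrm_scale_le[OF assms, of c] C0_nrm_nonneg[OF C0_scale_closed[OF assms, of c]] by simp
next
  case False
  have "scale (C0 K) (1 / c) (scale (C0 K) c f) = f"
    using False C0_carrierD(1)[OF assms]
    by (intro extensionalityI[of _ "topspace K"]) (auto simp: C0_sel)
  then have "nrm (C0 K) f \<le> cmod (1 / c) * nrm (C0 K) (scale (C0 K) c f)"
    using C0_nrm_scale_le[OF C0_scale_closed[OF assms, of c], of "1 / c"] by simp
  then have "cmod c * nrm (C0 K) f \<le> nrm (C0 K) (scale (C0 K) c f)"
    using False by (simp add: norm_divide field_simps)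
  then show ?thesis using C0_nrm_scale_le[OF assms, of c] by simp
qed

lemma C0_nrm_star:
  "nrm (C0 K) (star (C0 K) f) = nrm (C0 K) f"
proof -
  have "(\<lambda>x. cmod (star (C0 K) f x)) ` topspace K = (\<lambda>x. cmod (f x)) ` topspace K"
    by (intro image_cong) (auto simp: C0_sel)
  then show ?thesis by (simp add: C0_nrm_eq)
qed

lemma C0_nrm_cstar:
  assumes "f \<in> carrier (C0 K)"
  shows "nrm (C0 K) (mult (C0 K) (star (C0 K) f) f) = (nrm (C0 K) f)\<^sup>2"
proof (rule antisym)
  let ?p = "mult (C0 K) (star (C0 K) f) f"
  show "nrm (C0 K) ?p \<le> (nrm (C0 K) f)\<^sup>2"
    using C0_nrm_mult[OF C0_star_closed[OF assms] assms] by (simp add: C0_nrm_star power2_eq_square)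
  have p: "?p \<in> carrier (C0 K)" using C0_mult_closed[OF C0_star_closed[OF assms] assms] .
  have "nrm (C0 K) f \<le> sqrt (nrm (C0 K) ?p)"
  proof (rule C0_nrm_le)
    fix x assume x: "x \<in> topspace K"
    have "(cmod (f x))\<^sup>2 \<le> nrm (C0 K) ?p"
      using C0_nrm_upper[OF p x] x by (simp add: C0_sel norm_mult power2_eq_square)
    then show "cmod (f x) \<le> sqrt (nrm (C0 K) ?p)" by (rule real_le_rsqrt)
  qed (use C0_nrm_nonneg[OF p] in simp)
  then show "(nrm (C0 K) f)\<^sup>2 \<le> nrm (C0 K) ?p"
    by (metis C0_nrm_nonneg assms p power_mono real_sqrt_pow2)
qed

theorem comm_cstar_algebra_C0: "comm_cstar_algebra (C0 K)"
proof
  fix x assume x: "x \<in> carrier (C0 K)"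
  note e = C0_carrierD(1)[OF x]
  show "add (C0 K) x (zero (C0 K)) = x" "scale (C0 K) 1 x = x" "star (C0 K) (star (C0 K) x) = x"
    using e by (auto simp: C0_sel intro!: extensionalityI[of _ "topspace K"])
qed (auto simp: C0_add_closed C0_zero_closed C0_scale_closed C0_mult_closed C0_star_closed
    C0_nrm_nonneg C0_nrm_eq_0 C0_nrm_scale C0_nrm_triangle C0_nrm_mult C0_nrm_cstar C0_complete,
   auto simp: C0_sel fun_eq_iff algebra_simps)

end

theory Submission
  imports Defs
begin

text \<open>
  All conditions say that any countable union of compact sets misses a whole neighbourhood of
  infinity. A function \<open>f\<close> vanishing at infinity is nonzero only on the union of the sets where
  \<open>\<bar>f\<bar> \<ge> 1/n\<close>, which lie in compact sets; so if sigma-compact sets are precompact, then \<open>f\<close> has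
  compact support. A function of compact support has as local unit an Urysohn function that is
  \<open>1\<close> on the support (\<open>C0_locally_unital_if_compact_supports\<close>). Conversely, given compact sets
  \<open>C\<^sub>n\<close>, the function \<open>f = \<Sum>n. 2\<^sup>-\<^sup>n h\<^sub>n\<close>, with \<open>h\<^sub>n\<close> an Urysohn function for \<open>C\<^sub>n\<close>, is positive on
  every \<open>C\<^sub>n\<close>; a local unit for \<open>f\<close> equals \<open>1\<close> on all of \<open>\<Union>n. C\<^sub>n\<close>, and being small outside some
  compact set it traps the union there (\<open>sigma_compact_precompact_if_locally_unital\<close>).

  Two points make the remaining equivalences match. Since \<open>K\<close> is not compact, \<open>C0 K\<close> is never
  unital, and the complement of a precompact set always has an interior point; hence the condition
  at the point at infinity alone decides membership in the class. Local units and units only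
  involve product and involution, so they pass through a *-isomorphism.
\<close>

section \<open>Transport along *-isomorphisms\<close>

context cstar_algebra
begin

lemma star_iso_local_unit:
  assumes iso: "star_iso A B \<phi>" and h: "h \<in> carrier A" and a: "a \<in> carrier A"
  shows "local_unit B (\<phi> h) (\<phi> a) \<longleftrightarrow> local_unit A h a"
proof -
  have inj: "\<phi> x = \<phi> y \<longleftrightarrow> x = y" if "x \<in> carrier A" "y \<in> carrier A" for x y
    using iso that unfolding star_iso_def bij_betw_def inj_on_def by blast
  have "\<phi> h \<in> carrier B"
    using iso h unfolding star_iso_def bij_betw_def by blast
  moreover have "star B (\<phi> h) = \<phi> h \<longleftrightarrow> star A h = h"
    using inj[OF star_closed[OF h] h] iso h unfolding star_iso_def by metis
  moreover have "\<phi> a \<otimes>\<^bsub>B\<^esub> \<phi> h = \<phi> a \<longleftrightarrow> a \<otimes> h = a"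
    using inj[OF mult_closed[OF a h] a] iso h a unfolding star_iso_def by metis
  moreover have "\<phi> h \<otimes>\<^bsub>B\<^esub> \<phi> a = \<phi> a \<longleftrightarrow> h \<otimes> a = a"
    using inj[OF mult_closed[OF h a] a] iso h a unfolding star_iso_def by metis
  ultimately show ?thesis
    using h by (simp add: local_unit_def)
qed

lemma star_iso_locally_unital:
  assumes iso: "star_iso A B \<phi>"
  shows "locally_unital B \<longleftrightarrow> locally_unital A"
proof -
  have img: "carrier B = \<phi> ` carrier A"
    using iso by (simp add: star_iso_def bij_betw_def)
  have "(\<exists>h. local_unit B h (\<phi> a)) \<longleftrightarrow> (\<exists>h. local_unit A h a)" if a: "a \<in> carrier A" for a
  proof -
    have "(\<exists>h. local_unit B h (\<phi> a)) \<longleftrightarrow> (\<exists>h\<in>carrier A. local_unit B (\<phi> h) (\<phi> a))"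
      unfolding local_unit_def img by blast
    also have "\<dots> \<longleftrightarrow> (\<exists>h\<in>carrier A. local_unit A h a)"
      using star_iso_local_unit[OF iso _ a] by blast
    also have "\<dots> \<longleftrightarrow> (\<exists>h. local_unit A h a)"
      unfolding local_unit_def by blast
    finally show ?thesis .
  qed
  then show ?thesis
    unfolding locally_unital_def img by blast
qed

lemma star_iso_unital:
  assumes iso: "star_iso A B \<phi>"
  shows "unital B \<longleftrightarrow> unital A"
proof -
  have img: "carrier B = \<phi> ` carrier A" and inj: "inj_on \<phi> (carrier A)"
    using iso by (simp_all add: star_iso_def bij_betw_def)
  have "\<phi> e \<otimes>\<^bsub>B\<^esub> \<phi> a = \<phi> a \<and> \<phi> a \<otimes>\<^bsub>B\<^esub> \<phi> e = \<phi> a \<longleftrightarrow> e \<otimes> a = a \<and> a \<otimes> e = a"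
    if e: "e \<in> carrier A" and a: "a \<in> carrier A" for e a
  proof -
    have "\<phi> e \<otimes>\<^bsub>B\<^esub> \<phi> a = \<phi> (e \<otimes> a)" "\<phi> a \<otimes>\<^bsub>B\<^esub> \<phi> e = \<phi> (a \<otimes> e)"
      using iso e a unfolding star_iso_def by metis+
    then show ?thesis
      using inj_on_eq_iff[OF inj] mult_closed e a by simp
  qed
  then show ?thesis
    unfolding unital_def img by (simp cong: ball_cong bex_cong)
qed

end

section \<open>Precompact sets and the class K_IV\<close>

lemma precompactin_iff_subset_compactin:
  assumes "Hausdorff_space K"
  shows "precompactin K S \<longleftrightarrow> (\<exists>C. compactin K C \<and> S \<subseteq> C)"
proof
  assume "precompactin K S"
  then show "\<exists>C. compactin K C \<and> S \<subseteq> C"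
    unfolding precompactin_def using closure_of_subset by blast
next
  assume "\<exists>C. compactin K C \<and> S \<subseteq> C"
  then obtain C where C: "compactin K C" "S \<subseteq> C" by blast
  then have "K closure_of S \<subseteq> C"
    by (intro closure_of_minimal compactin_imp_closedin[OF assms])
  then show "precompactin K S"
    using C compactin_subset_topspace[OF C(1)] closed_compactin[OF C(1)]
    by (auto simp: precompactin_def)
qed

text \<open>
  The neighbourhoods of infinity are exactly the complements of subsets of closed compact sets.
\<close>

lemma infinity_interior_complement_iff:
  assumes "Hausdorff_space K"
  shows "None \<in> Alexandroff_compactification K interior_of
             (topspace (Alexandroff_compactification K) - Some ` S)
         \<longleftrightarrow> (\<exists>C. compactin K C \<and> S \<inter> topspace K \<subseteq> C)"
proof
  assume "None \<in> Alexandroff_compactification K interior_of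
             (topspace (Alexandroff_compactification K) - Some ` S)"
  then obtain U where U: "openin (Alexandroff_compactification K) U" "None \<in> U"
    "U \<subseteq> topspace (Alexandroff_compactification K) - Some ` S"
    unfolding interior_of_def by blast
  then obtain C where C: "compactin K C" "U = insert None (Some ` (topspace K - C))"
    by (auto simp: openin_Alexandroff_compactification)
  then have "S \<inter> topspace K \<subseteq> C"
    using U(3) by auto
  then show "\<exists>C. compactin K C \<and> S \<inter> topspace K \<subseteq> C" using C(1) by blast
next
  assume "\<exists>C. compactin K C \<and> S \<inter> topspace K \<subseteq> C"
  then obtain C where C: "compactin K C" "S \<inter> topspace K \<subseteq> C" by blast
  define U where "U = insert None (Some ` (topspace K - C))"
  have "openin (Alexandroff_compactification K) U"
    unfolding U_def openin_Alexandroff_compactification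
    using C(1) compactin_imp_closedin[OF assms C(1)] by blast
  moreover have "U \<subseteq> topspace (Alexandroff_compactification K) - Some ` S"
    using C(2) by (auto simp: U_def)
  ultimately show "None \<in> Alexandroff_compactification K interior_of
             (topspace (Alexandroff_compactification K) - Some ` S)"
    unfolding interior_of_def U_def by blast
qed

text \<open>
  Outside a compact set containing \<open>S\<close> there is still a nonempty open set, because the space is
  not compact. So of the two requirements in the definition of the class, the one at infinity
  implies the other.
\<close>

lemma class_IV_iff_sigma_compact_precompact:
  assumes H: "Hausdorff_space K" and nc: "\<not> compact_space K"
  shows "class_IV K \<longleftrightarrow> (\<forall>S. sigma_compactin K S \<longrightarrow> precompactin K S)"
proof -
  have "K interior_of (topspace K - S) \<noteq> {} \<and>
      None \<in> Alexandroff_compactification K interior_of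
               (topspace (Alexandroff_compactification K) - Some ` S)
      \<longleftrightarrow> precompactin K S" if S: "sigma_compactin K S" for S
  proof -
    have "S \<subseteq> topspace K"
      using S compactin_subset_topspace unfolding sigma_compactin_def by blast
    then have "S \<inter> topspace K = S" by blast
    then have inf: "None \<in> Alexandroff_compactification K interior_of
               (topspace (Alexandroff_compactification K) - Some ` S) \<longleftrightarrow> precompactin K S"
      using infinity_interior_complement_iff[OF H, of S] precompactin_iff_subset_compactin[OF H, of S]
      by simp
    have "K interior_of (topspace K - S) \<noteq> {}" if "precompactin K S"
    proof -
      have "K closure_of S \<noteq> topspace K"
        using that nc unfolding precompactin_def compact_space_def by auto
      then show ?thesis
        using closure_of_subset_topspace[of K S] by (auto simp: interior_of_complement)
    qed
    then show ?thesis using inf by blast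
  qed
  then show ?thesis unfolding class_IV_def by blast
qed

section \<open>Functions with compact support\<close>

lemma compact_supports_if_sigma_compact_precompact:
  assumes P: "\<And>S. sigma_compactin K S \<Longrightarrow> precompactin K S"
    and f: "f \<in> carrier (C0 K)"
  shows "vanishes_outside_compact K f"
proof -
  have "\<exists>C. compactin K C \<and> (\<forall>x\<in>topspace K - C. cmod (f x) < 1 / Suc n)" for n
    using C0_carrierD(3)[OF f] unfolding vanishes_at_infinity_def by simp
  then obtain C where C: "\<And>n. compactin K (C n)"
    "\<And>n x. x \<in> topspace K - C n \<Longrightarrow> cmod (f x) < 1 / Suc n"
    by metis
  let ?S = "\<Union>(range C)"
  have "sigma_compactin K ?S"
    unfolding sigma_compactin_def using C(1) by (intro exI[of _ "range C"]) auto
  then have S: "?S \<subseteq> topspace K" "compactin K (K closure_of ?S)"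
    using P[of ?S] by (simp_all add: precompactin_def)
  have "f x = 0" if x: "x \<in> topspace K - K closure_of ?S" for x
  proof (rule ccontr)
    assume "f x \<noteq> 0"
    then obtain n where "1 / Suc n < cmod (f x)"
      using reals_Archimedean[of "cmod (f x)"] by (auto simp: inverse_eq_divide)
    moreover have "x \<notin> C n" using x closure_of_subset[OF S(1)] by blast
    ultimately show False using C(2)[of x n] x by simp
  qed
  then show ?thesis unfolding vanishes_outside_compact_def using S(2) by blast
qed

lemma C0_Urysohn:
  assumes lc: "locally_compact_space K" and H: "Hausdorff_space K" and C: "compactin K C"
  obtains h where "h \<in> carrier (C0 K)"
    "\<And>x. x \<in> topspace K \<Longrightarrow> h x \<in> \<real> \<and> 0 \<le> Re (h x) \<and> Re (h x) \<le> 1"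
    "\<And>x. x \<in> C \<Longrightarrow> h x = 1"
proof -
  obtain U L where UL: "openin K U" "compactin K L" "C \<subseteq> U" "U \<subseteq> L"
    using lc C locally_compact_space_compact_closed_compact[of K] H by blast
  have cr: "completely_regular_space K"
    using lc H locally_compact_Hausdorff_imp_regular_space
      locally_compact_regular_imp_completely_regular_space by blast
  have "closedin K (topspace K - U)" "disjnt C (topspace K - U)"
    using UL by (auto simp: disjnt_def)
  then obtain g where g: "continuous_map K (top_of_set {0..1::real}) g"
    "g ` (topspace K - U) \<subseteq> {0}" "g ` C \<subseteq> {1}"
    using Urysohn_completely_regular_compact_closed[OF zero_le_one cr C] by metis
  have g01: "0 \<le> g x \<and> g x \<le> 1" if "x \<in> topspace K" for x
    using g(1) that by (auto simp: continuous_map_in_subtopology)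
  define h where "h = (\<lambda>x\<in>topspace K. complex_of_real (g x))"
  have "continuous_map K euclidean (complex_of_real \<circ> g)"
  proof (rule continuous_map_compose)
    show "continuous_map K euclidean g" using g(1) by (simp add: continuous_map_in_subtopology)
    show "continuous_map euclidean euclidean complex_of_real"
      by (simp add: continuous_map_iff_continuous2 continuous_on_of_real)
  qed
  then have "continuous_map K euclidean h"
    by (rule continuous_map_eq) (simp add: h_def)
  moreover have "vanishes_at_infinity K h"
    unfolding vanishes_at_infinity_def
  proof (intro allI impI exI conjI ballI)
    fix \<epsilon> :: real and x assume "0 < \<epsilon>" "x \<in> topspace K - L"
    then have "g x = 0" using g(2) UL(4) by blast
    then show "cmod (h x) < \<epsilon>" using \<open>0 < \<epsilon>\<close> \<open>x \<in> topspace K - L\<close> by (simp add: h_def)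
  qed (rule UL(2))
  ultimately have "h \<in> carrier (C0 K)"
    by (intro C0_carrierI) (auto simp: h_def)
  then show thesis
    using g(3) g01 compactin_subset_topspace[OF C] by (intro that[of h]) (auto simp: h_def)
qed

lemma C0_locally_unital_if_compact_supports:
  assumes lc: "locally_compact_space K" and H: "Hausdorff_space K"
    and supp: "\<And>f. f \<in> carrier (C0 K) \<Longrightarrow> vanishes_outside_compact K f"
  shows "locally_unital (C0 K)"
  unfolding locally_unital_def
proof
  fix f assume f: "f \<in> carrier (C0 K)"
  then obtain C where C: "compactin K C" "\<And>x. x \<in> topspace K - C \<Longrightarrow> f x = 0"
    using supp[OF f] unfolding vanishes_outside_compact_def by blast
  obtain h where h: "h \<in> carrier (C0 K)" "\<And>x. x \<in> topspace K \<Longrightarrow> h x \<in> \<real>"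
    "\<And>x. x \<in> C \<Longrightarrow> h x = 1"
    using C0_Urysohn[OF lc H C(1)] by metis
  have fh: "f x * h x = f x" if "x \<in> topspace K" for x
    using h(3)[of x] C(2)[of x] that by (cases "x \<in> C") auto
  have "star (C0 K) h = h"
    using h(2) C0_carrierD(1)[OF h(1)]
    by (intro extensionalityI[of _ "topspace K"]) (auto simp: C0_sel Reals_cnj_iff)
  moreover have "mult (C0 K) f h = f" "mult (C0 K) h f = f"
    using fh C0_carrierD(1)[OF f]
    by (auto intro!: extensionalityI[of _ "topspace K"] simp: C0_sel mult.commute)
  ultimately show "\<exists>h. local_unit (C0 K) h f"
    using h(1) unfolding local_unit_def by blast
qed

section \<open>Units and local units force compactness\<close>

text \<open>
  A vanishing function can equal \<open>1\<close> only on a subset of a compact set. Applied to a unit this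
  gives compactness of the space, applied to a local unit precompactness of a sigma-compact set.
\<close>

lemma C0_level_one_compact:
  assumes "h \<in> carrier (C0 K)"
  obtains C where "compactin K C" "\<And>x. \<lbrakk>x \<in> topspace K; h x = 1\<rbrakk> \<Longrightarrow> x \<in> C"
proof -
  obtain C where C: "compactin K C" "\<forall>x\<in>topspace K - C. cmod (h x) < 1"
    using C0_carrierD(3)[OF assms] unfolding vanishes_at_infinity_def by (metis zero_less_one)
  have "x \<in> C" if "x \<in> topspace K" "h x = 1" for x
    using bspec[OF C(2), of x] that by auto
  then show thesis using C(1) that by blast
qed

lemma C0_not_unital:
  assumes lc: "locally_compact_space K" and H: "Hausdorff_space K" and nc: "\<not> compact_space K"
  shows "\<not> unital (C0 K)"
proof
  assume "unital (C0 K)"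
  then obtain e where e: "e \<in> carrier (C0 K)"
    "\<And>f. f \<in> carrier (C0 K) \<Longrightarrow> mult (C0 K) e f = f"
    unfolding unital_def by blast
  have e1: "e x = 1" if x: "x \<in> topspace K" for x
  proof -
    obtain h where h: "h \<in> carrier (C0 K)" "h x = 1"
      using C0_Urysohn[OF lc H, of "{x}"] x by (metis compactin_sing singletonI)
    have "e x * h x = h x"
      using fun_cong[OF e(2)[OF h(1)], of x] x by (simp add: C0_sel)
    then show ?thesis using h(2) by simp
  qed
  obtain C where C: "compactin K C" "\<And>x. \<lbrakk>x \<in> topspace K; e x = 1\<rbrakk> \<Longrightarrow> x \<in> C"
    using C0_level_one_compact[OF e(1)] by metis
  have "C = topspace K"
    using C(2) e1 compactin_subset_topspace[OF C(1)] by blast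
  then show False
    using C(1) nc by (simp add: compact_space_def)
qed

lemma C0_uniform_limit:
  assumes s: "\<And>n. restrict (s n) (topspace K) \<in> carrier (C0 K)"
    and lim: "uniform_limit (topspace K) s l sequentially"
  shows "restrict l (topspace K) \<in> carrier (C0 K)"
proof (rule C0_carrierI)
  have close: "\<exists>N. \<forall>n\<ge>N. \<forall>x\<in>topspace K. dist (s n x) (l x) < e" if "0 < e" for e
    using lim that unfolding uniform_limit_iff eventually_sequentially by blast
  have "continuous_map K (Met_TC.mtopology :: complex topology) (restrict l (topspace K))"
  proof (rule Met_TC.continuous_map_uniform_limit
      [where F = sequentially and f = "\<lambda>n. restrict (s n) (topspace K)"])
    show "\<forall>\<^sub>F n in sequentially. continuous_map K Met_TC.mtopology (restrict (s n) (topspace K))"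
      using C0_carrierD(2)[OF s] by simp
    fix e :: real assume "0 < e"
    then show "\<forall>\<^sub>F n in sequentially. \<forall>x\<in>topspace K. restrict l (topspace K) x \<in> UNIV \<and>
        dist (restrict (s n) (topspace K) x) (restrict l (topspace K) x) < e"
      using close unfolding eventually_sequentially by simp
  qed auto
  then show "continuous_map K euclidean (restrict l (topspace K))" by simp
  show "vanishes_at_infinity K (restrict l (topspace K))"
    unfolding vanishes_at_infinity_def
  proof (intro allI impI)
    fix e :: real assume "0 < e"
    then obtain n where n: "\<And>x. x \<in> topspace K \<Longrightarrow> dist (s n x) (l x) < e / 2"
      using close[of "e / 2"] by auto
    obtain C where C: "compactin K C"
      "\<And>x. x \<in> topspace K - C \<Longrightarrow> cmod (restrict (s n) (topspace K) x) < e / 2"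
      using C0_carrierD(3)[OF s[of n]] \<open>0 < e\<close> unfolding vanishes_at_infinity_def
      by (metis half_gt_zero)
    have "cmod (restrict l (topspace K) x) < e" if "x \<in> topspace K - C" for x
      using n[of x] C(2)[of x] that norm_triangle_ineq2[of "l x" "s n x"]
      by (auto simp: dist_norm norm_minus_commute)
    then show "\<exists>C. compactin K C \<and> (\<forall>x\<in>topspace K - C. cmod (restrict l (topspace K) x) < e)"
      using C(1) by blast
  qed
qed auto

lemma C0_suminf:
  assumes f: "\<And>n. f n \<in> carrier (C0 K)"
    and le: "\<And>n x. x \<in> topspace K \<Longrightarrow> cmod (f n x) \<le> M n" and M: "summable M"
  shows "(\<lambda>x\<in>topspace K. \<Sum>n. f n x) \<in> carrier (C0 K)"
proof (rule C0_uniform_limit)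
  show "uniform_limit (topspace K) (\<lambda>n x. \<Sum>i<n. f i x) (\<lambda>x. \<Sum>n. f n x) sequentially"
    by (rule Weierstrass_m_test[OF le M])
  show "(\<lambda>x\<in>topspace K. \<Sum>i<n. f i x) \<in> carrier (C0 K)" for n
  proof (induction n)
    case 0
    then show ?case using C0_zero_closed[of K] unfolding C0_sel by (simp only: lessThan_0 sum.empty)
  next
    case (Suc n)
    have "(\<lambda>x\<in>topspace K. \<Sum>i<Suc n. f i x) = add (C0 K) (\<lambda>x\<in>topspace K. \<Sum>i<n. f i x) (f n)"
      by (auto simp: C0_sel)
    then show ?case using C0_add_closed[OF Suc f[of n]] by (simp only:)
  qed
qed

text \<open>
  The weights \<open>2\<^sup>-\<^sup>n\<close> make the sum of the Urysohn functions converge uniformly, and nonnegativity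
  keeps the summands from cancelling.
\<close>

lemma C0_nonzero_on_sigma_compact:
  assumes lc: "locally_compact_space K" and H: "Hausdorff_space K" and S: "sigma_compactin K S"
  obtains f where "f \<in> carrier (C0 K)" "\<And>x. x \<in> S \<Longrightarrow> f x \<noteq> 0"
proof -
  obtain \<C> where \<C>: "countable \<C>" "\<And>C. C \<in> \<C> \<Longrightarrow> compactin K C" "S = \<Union>\<C>"
    using S unfolding sigma_compactin_def by blast
  (* The empty set is added only so that the family can be enumerated by the natural numbers. *)
  define C where "C = from_nat_into (insert {} \<C>)"
  have rC: "range C = insert {} \<C>"
    unfolding C_def using \<C>(1) by (intro range_from_nat_into) auto
  have "\<exists>h. h \<in> carrier (C0 K) \<and>
      (\<forall>x\<in>topspace K. h x \<in> \<real> \<and> 0 \<le> Re (h x) \<and> Re (h x) \<le> 1) \<and> (\<forall>x\<in>C n. h x = 1)" for n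
  proof -
    have "C n \<in> insert {} \<C>" using rC by blast
    then have "compactin K (C n)" using \<C>(2) by auto
    then show ?thesis using C0_Urysohn[OF lc H] by metis
  qed
  then obtain h where h: "\<And>n. h n \<in> carrier (C0 K)"
    "\<And>n x. x \<in> topspace K \<Longrightarrow> h n x \<in> \<real> \<and> 0 \<le> Re (h n x) \<and> Re (h n x) \<le> 1"
    "\<And>n x. x \<in> C n \<Longrightarrow> h n x = 1"
    by metis
  define g where "g n = scale (C0 K) (of_real ((1/2) ^ n)) (h n)" for n
  have g: "g n x = of_real ((1/2) ^ n * Re (h n x))" if "x \<in> topspace K" for n x
    using h(2)[OF that, of n] that by (simp add: g_def C0_sel complex_is_Real_iff complex_eq_iff)
  have gc: "g n \<in> carrier (C0 K)" for n
    unfolding g_def by (rule C0_scale_closed[OF h(1)])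
  have le: "cmod (g n x) \<le> (1/2) ^ n" if "x \<in> topspace K" for n x
    using h(2)[OF that, of n] unfolding g[OF that] norm_of_real
    by (simp add: abs_mult mult_left_le)
  have sm: "summable (\<lambda>n. (1/2 :: real) ^ n)" by (simp add: summable_geometric)
  have "(\<Sum>n. g n x) \<noteq> 0" if x: "x \<in> S" for x
  proof -
    have xK: "x \<in> topspace K"
      using x \<C>(2,3) compactin_subset_topspace by blast
    obtain m where m: "x \<in> C m" using x \<C>(3) rC by (metis UnionE insertCI rangeE)
    have sumg: "summable (\<lambda>n. (1/2) ^ n * Re (h n x))"
      by (rule summable_comparison_test'[OF sm])
        (use h(2)[OF xK] in \<open>auto simp: abs_mult mult_left_le\<close>)
    have "0 < (\<Sum>n. (1/2) ^ n * Re (h n x))"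
      using h(2)[OF xK] h(3)[OF m] by (intro suminf_pos2[OF sumg, of m]) auto
    moreover have "(\<Sum>n. g n x) = of_real (\<Sum>n. (1/2) ^ n * Re (h n x))"
      unfolding g[OF xK] by (rule suminf_of_real[OF sumg, symmetric])
    ultimately show ?thesis by simp
  qed
  moreover have "S \<subseteq> topspace K"
    using \<C>(2,3) compactin_subset_topspace by blast
  ultimately show thesis
    using C0_suminf[OF gc le sm] by (intro that[of "\<lambda>x\<in>topspace K. \<Sum>n. g n x"]) auto
qed

lemma sigma_compact_precompact_if_locally_unital:
  assumes lc: "locally_compact_space K" and H: "Hausdorff_space K"
    and lu: "locally_unital (C0 K)" and S: "sigma_compactin K S"
  shows "precompactin K S"
proof -
  obtain f where f: "f \<in> carrier (C0 K)" "\<And>x. x \<in> S \<Longrightarrow> f x \<noteq> 0"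
    using C0_nonzero_on_sigma_compact[OF lc H S] by metis
  obtain h where h: "h \<in> carrier (C0 K)" "mult (C0 K) f h = f"
    using lu f(1) unfolding locally_unital_def local_unit_def by blast
  have SK: "S \<subseteq> topspace K"
    using S compactin_subset_topspace unfolding sigma_compactin_def by blast
  have "h x = 1" if x: "x \<in> S" for x
  proof -
    have "f x * h x = f x"
      using fun_cong[OF h(2), of x] x SK by (auto simp: C0_sel)
    then show ?thesis using f(2)[OF x] by simp
  qed
  moreover obtain C where "compactin K C" "\<And>x. \<lbrakk>x \<in> topspace K; h x = 1\<rbrakk> \<Longrightarrow> x \<in> C"
    using C0_level_one_compact[OF h(1)] by metis
  ultimately show ?thesis
    using SK precompactin_iff_subset_compactin[OF H] by blast
qed

section \<open>The equivalence\<close>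

theorem theorem3p3:
  fixes A :: "('a, 'm) star_algebra_scheme"
    and K :: "'k topology"
  assumes "locally_compact_space K" and "Hausdorff_space K"
    and "\<not> compact_space K"
    and "comm_cstar_algebra A" and "star_isomorphic A (C0 K)"
  shows "(locally_unital A \<and> \<not> unital A
            \<longleftrightarrow> locally_unital (C0 K) \<and> \<not> unital (C0 K)) \<and>
         (locally_unital (C0 K) \<and> \<not> unital (C0 K) \<longleftrightarrow> class_IV K) \<and>
         (class_IV K \<longleftrightarrow> (\<forall>S. sigma_compactin K S \<longrightarrow> precompactin K S)) \<and>
         (class_IV K \<longleftrightarrow> (\<forall>f\<in>carrier (C0 K). vanishes_outside_compact K f))"
proof -
  interpret A: comm_cstar_algebra A by fact
  obtain \<phi> where iso: "star_iso A (C0 K) \<phi>"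
    using assms(5) unfolding star_isomorphic_def by blast
  note nu = C0_not_unital[OF assms(1-3)]
  note IV = class_IV_iff_sigma_compact_precompact[OF assms(2,3)]
  have P_supp: "\<forall>f\<in>carrier (C0 K). vanishes_outside_compact K f"
    if "\<forall>S. sigma_compactin K S \<longrightarrow> precompactin K S"
    using that compact_supports_if_sigma_compact_precompact by blast
  have supp_lu: "locally_unital (C0 K)" if "\<forall>f\<in>carrier (C0 K). vanishes_outside_compact K f"
    using that C0_locally_unital_if_compact_supports[OF assms(1,2)] by blast
  have lu_P: "\<forall>S. sigma_compactin K S \<longrightarrow> precompactin K S" if "locally_unital (C0 K)"
    using that sigma_compact_precompact_if_locally_unital[OF assms(1,2)] by blast
  show ?thesis
    using A.star_iso_locally_unital[OF iso] A.star_iso_unital[OF iso] nu IV P_supp supp_lu lu_P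
    by blast
qed

end
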